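(* Let $\langle U,\theta\rangle$ be an approximation space and let $C(R_\theta)$ denote the center of its principal rough set algebra $R_\theta$. Let $E$ be the indexing set for the equivalence classes of $\theta$ and, for every $e\in E$, let $y_e\in U$ be a chosen representative of the class indexed by $e$. Then $$C(R_\theta)=\Big\{\Big\langle \bigcup_{e\in B}\theta_{y_e},\ \bigcup_{e\in B}\theta_{y_e}\Big\rangle : B\in\mathcal{P}(E)\Big\},$$ where $\mathcal{P}(E)$ denotes the power set of $E$ (and $B=\emptyset$ yields the rough set $\langle\emptyset,\emptyset\rangle$).
   Context: An approximation space $\langle U,\theta\rangle$ is a nonempty set $U$ with an equivalence relation $\theta$; $\theta_x$ denotes the $\theta$-class of $x$. The indexing set $E$ of the classes is a set in bijection with the set of $\theta$-classes. For $X\subseteq U$, $\overline{X}=\bigcup\{\theta_x:\theta_x\cap X\neq\emptyset\}$ and $\underline{X}=\bigcup\{\theta_x:\theta_x\subseteq X\}$; the pair $\langle\underline{X},\overline{X}\rangle$ is a rough set. $R_\theta$ is the set of all rough sets $\langle\underline{X},\overline{X}\rangle$, $X\subseteq U$. Complements $^c$ are in $U$. The principal rough set algebra, also denoted $R_\theta$, has $0=\langle\emptyset,\emptyset\rangle$, $1=\langle U,U\rangle$, componentwise union as $\vee$, componentwise intersection as $\wedge$, $\langle\underline{X},\overline{X}\rangle^*=\langle\overline{X}^c,\overline{X}^c\rangle$ and $\langle\underline{X},\overline{X}\rangle^+=\langle\underline{X}^c,\underline{X}^c\rangle$. It is a regular double Stone algebra (a bounded distributive lattice with pseudocomplement $^*$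 and dual pseudocomplement $^+$ satisfying $x^*\vee x^{**}=1$, $x^+\wedge x^{++}=0$, and $x\wedge x^+\le y\vee y^*$ for all $x,y$). The center of a regular double Stone algebra $L$ is $C(L)=\{x\in L:x^*=x^+\}$. *)

theory Defs
  imports Main
begin

section \<open>Regular double Stone algebras\<close>

record 'a dsa =
  dsa_carr :: "'a set"
  dsa_zero :: 'a
  dsa_one :: 'a
  dsa_join :: "'a \<Rightarrow> 'a \<Rightarrow> 'a"
  dsa_meet :: "'a \<Rightarrow> 'a \<Rightarrow> 'a"
  dsa_star :: "'a \<Rightarrow> 'a"
  dsa_plus :: "'a \<Rightarrow> 'a"

(* The lattice order is x \<le> y iff dsa_meet L x y = x, so dsa_star and dsa_plus are the
   pseudocomplement and the dual pseudocomplement. *)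
locale regular_double_stone_algebra =
  fixes L :: "('a, 'b) dsa_scheme"
  assumes zero_closed: "dsa_zero L \<in> dsa_carr L"
    and one_closed: "dsa_one L \<in> dsa_carr L"
    and join_closed: "\<lbrakk>x \<in> dsa_carr L; y \<in> dsa_carr L\<rbrakk> \<Longrightarrow> dsa_join L x y \<in> dsa_carr L"
    and meet_closed: "\<lbrakk>x \<in> dsa_carr L; y \<in> dsa_carr L\<rbrakk> \<Longrightarrow> dsa_meet L x y \<in> dsa_carr L"
    and star_closed: "x \<in> dsa_carr L \<Longrightarrow> dsa_star L x \<in> dsa_carr L"
    and plus_closed: "x \<in> dsa_carr L \<Longrightarrow> dsa_plus L x \<in> dsa_carr L"
    and join_assoc: "\<lbrakk>x \<in> dsa_carr L; y \<in> dsa_carr L; z \<in> dsa_carr L\<rbrakk> \<Longrightarrow>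
      dsa_join L (dsa_join L x y) z = dsa_join L x (dsa_join L y z)"
    and meet_assoc: "\<lbrakk>x \<in> dsa_carr L; y \<in> dsa_carr L; z \<in> dsa_carr L\<rbrakk> \<Longrightarrow>
      dsa_meet L (dsa_meet L x y) z = dsa_meet L x (dsa_meet L y z)"
    and join_comm: "\<lbrakk>x \<in> dsa_carr L; y \<in> dsa_carr L\<rbrakk> \<Longrightarrow> dsa_join L x y = dsa_join L y x"
    and meet_comm: "\<lbrakk>x \<in> dsa_carr L; y \<in> dsa_carr L\<rbrakk> \<Longrightarrow> dsa_meet L x y = dsa_meet L y x"
    and join_absorb: "\<lbrakk>x \<in> dsa_carr L; y \<in> dsa_carr L\<rbrakk> \<Longrightarrow> dsa_join L x (dsa_meet L x y) = x"
    and meet_absorb: "\<lbrakk>x \<in> dsa_carr L; y \<in> dsa_carr L\<rbrakk> \<Longrightarrow> dsa_meet L x (dsa_join L x y) = x"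
    and distrib: "\<lbrakk>x \<in> dsa_carr L; y \<in> dsa_carr L; z \<in> dsa_carr L\<rbrakk> \<Longrightarrow>
      dsa_meet L x (dsa_join L y z) = dsa_join L (dsa_meet L x y) (dsa_meet L x z)"
    and zero_least: "x \<in> dsa_carr L \<Longrightarrow> dsa_meet L (dsa_zero L) x = dsa_zero L"
    and one_greatest: "x \<in> dsa_carr L \<Longrightarrow> dsa_meet L x (dsa_one L) = x"
    and pseudocomplement: "\<lbrakk>x \<in> dsa_carr L; y \<in> dsa_carr L\<rbrakk> \<Longrightarrow>
      dsa_meet L x y = dsa_zero L \<longleftrightarrow> dsa_meet L y (dsa_star L x) = y"
    and dual_pseudocomplement: "\<lbrakk>x \<in> dsa_carr L; y \<in> dsa_carr L\<rbrakk> \<Longrightarrow>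
      dsa_join L x y = dsa_one L \<longleftrightarrow> dsa_meet L (dsa_plus L x) y = dsa_plus L x"
    and stone: "x \<in> dsa_carr L \<Longrightarrow> dsa_join L (dsa_star L x) (dsa_star L (dsa_star L x)) = dsa_one L"
    and dual_stone: "x \<in> dsa_carr L \<Longrightarrow> dsa_meet L (dsa_plus L x) (dsa_plus L (dsa_plus L x)) = dsa_zero L"
    and regular: "\<lbrakk>x \<in> dsa_carr L; y \<in> dsa_carr L\<rbrakk> \<Longrightarrow>
      dsa_meet L (dsa_meet L x (dsa_plus L x)) (dsa_join L y (dsa_star L y)) = dsa_meet L x (dsa_plus L x)"

definition center :: "('a, 'b) dsa_scheme \<Rightarrow> 'a set" where
  "center L = {x \<in> dsa_carr L. dsa_star L x = dsa_plus L x}"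


section \<open>Rough sets\<close>

definition approximation_space :: "'a set \<Rightarrow> 'a rel \<Rightarrow> bool" where
  "approximation_space U \<theta> \<longleftrightarrow> U \<noteq> {} \<and> equiv U \<theta>"

definition upper_approx :: "'a set \<Rightarrow> 'a rel \<Rightarrow> 'a set \<Rightarrow> 'a set" where
  "upper_approx U \<theta> X = \<Union>{\<theta> `` {x} | x. x \<in> U \<and> \<theta> `` {x} \<inter> X \<noteq> {}}"

definition lower_approx :: "'a set \<Rightarrow> 'a rel \<Rightarrow> 'a set \<Rightarrow> 'a set" where
  "lower_approx U \<theta> X = \<Union>{\<theta> `` {x} | x. x \<in> U \<and> \<theta> `` {x} \<subseteq> X}"

definition rough_set :: "'a set \<Rightarrow> 'a rel \<Rightarrow> 'a set \<Rightarrow> 'a set \<times> 'a set" where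
  "rough_set U \<theta> X = (lower_approx U \<theta> X, upper_approx U \<theta> X)"

definition rough_set_algebra :: "'a set \<Rightarrow> 'a rel \<Rightarrow> ('a set \<times> 'a set) dsa" where
  "rough_set_algebra U \<theta> =
    \<lparr>dsa_carr = {rough_set U \<theta> X | X. X \<subseteq> U},
     dsa_zero = ({}, {}),
     dsa_one = (U, U),
     dsa_join = (\<lambda>p q. (fst p \<union> fst q, snd p \<union> snd q)),
     dsa_meet = (\<lambda>p q. (fst p \<inter> fst q, snd p \<inter> snd q)),
     dsa_star = (\<lambda>p. (U - snd p, U - snd p)),
     dsa_plus = (\<lambda>p. (U - fst p, U - fst p))\<rparr>"

lemma lower_approx_eq:
  assumes "equiv U \<theta>" "X \<subseteq> U"
  shows "lower_approx U \<theta> X = {x \<in> U. \<theta> `` {x} \<subseteq> X}"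
proof (intro set_eqI iffI)
  fix x assume "x \<in> lower_approx U \<theta> X"
  then obtain z where z: "(z, x) \<in> \<theta>" "\<theta> `` {z} \<subseteq> X"
    unfolding lower_approx_def by blast
  then have "\<theta> `` {z} = \<theta> `` {x}" "x \<in> U"
    using assms(1) by (auto simp: equiv_class_eq_iff)
  then show "x \<in> {x \<in> U. \<theta> `` {x} \<subseteq> X}" using z by simp
next
  fix x assume "x \<in> {x \<in> U. \<theta> `` {x} \<subseteq> X}"
  then show "x \<in> lower_approx U \<theta> X"
    using equiv_class_self[OF assms(1)] unfolding lower_approx_def by blast
qed

lemma upper_approx_eq:
  assumes "equiv U \<theta>" "X \<subseteq> U"
  shows "upper_approx U \<theta> X = {x \<in> U. \<theta> `` {x} \<inter> X \<noteq> {}}"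
proof (intro set_eqI iffI)
  fix x assume "x \<in> upper_approx U \<theta> X"
  then obtain z where z: "(z, x) \<in> \<theta>" "\<theta> `` {z} \<inter> X \<noteq> {}"
    unfolding upper_approx_def by blast
  then have "\<theta> `` {z} = \<theta> `` {x}" "x \<in> U"
    using assms(1) by (auto simp: equiv_class_eq_iff)
  then show "x \<in> {x \<in> U. \<theta> `` {x} \<inter> X \<noteq> {}}" using z by simp
next
  fix x assume "x \<in> {x \<in> U. \<theta> `` {x} \<inter> X \<noteq> {}}"
  then show "x \<in> upper_approx U \<theta> X"
    using equiv_class_self[OF assms(1)] unfolding upper_approx_def by blast
qed

(* A singleton class is either inside X or disjoint from X, so it never lies in the boundary. *)
lemma rough_set_iff:
  assumes eq: "equiv U \<theta>"
  shows "(\<exists>X\<subseteq>U. (A, B) = rough_set U \<theta> X) \<longleftrightarrow>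
    A \<subseteq> B \<and> B \<subseteq> U \<and> \<theta> `` A \<subseteq> A \<and> \<theta> `` B \<subseteq> B \<and> (\<forall>x\<in>B - A. \<theta> `` {x} \<noteq> {x})"
proof
  assume "\<exists>X\<subseteq>U. (A, B) = rough_set U \<theta> X"
  then obtain X where XU: "X \<subseteq> U" and "(A, B) = rough_set U \<theta> X" by blast
  then have X: "X \<subseteq> U" "A = {x \<in> U. \<theta> `` {x} \<subseteq> X}" "B = {x \<in> U. \<theta> `` {x} \<inter> X \<noteq> {}}"
    unfolding rough_set_def prod.inject lower_approx_eq[OF eq XU] upper_approx_eq[OF eq XU] by simp_all
  have cl: "\<theta> `` {x} = \<theta> `` {y} \<and> x \<in> U \<and> y \<in> U" if "(x, y) \<in> \<theta>" for x y
    using that eq by (auto simp: equiv_class_eq_iff)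
  have self: "x \<in> \<theta> `` {x}" if "x \<in> U" for x
    using that equiv_class_self[OF eq] by auto
  have "A \<subseteq> B" using X self by blast
  moreover have "\<theta> `` A \<subseteq> A"
  proof
    fix y assume "y \<in> \<theta> `` A"
    then obtain x where "x \<in> A" "(x, y) \<in> \<theta>" by auto
    then show "y \<in> A" using cl[of x y] X(2) by simp
  qed
  moreover have "\<theta> `` B \<subseteq> B"
  proof
    fix y assume "y \<in> \<theta> `` B"
    then obtain x where "x \<in> B" "(x, y) \<in> \<theta>" by auto
    then show "y \<in> B" using cl[of x y] X(3) by simp
  qed
  moreover have "\<forall>x\<in>B - A. \<theta> `` {x} \<noteq> {x}"
  proof
    fix x assume "x \<in> B - A"
    then have "\<theta> `` {x} \<inter> X \<noteq> {}" "\<not> \<theta> `` {x} \<subseteq> X" using X by auto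
    then have "\<theta> `` {x} = {x} \<Longrightarrow> False" by (simp only:) blast
    then show "\<theta> `` {x} \<noteq> {x}" by blast
  qed
  ultimately show "A \<subseteq> B \<and> B \<subseteq> U \<and> \<theta> `` A \<subseteq> A \<and> \<theta> `` B \<subseteq> B \<and> (\<forall>x\<in>B - A. \<theta> `` {x} \<noteq> {x})"
    using X by auto
next
  assume "A \<subseteq> B \<and> B \<subseteq> U \<and> \<theta> `` A \<subseteq> A \<and> \<theta> `` B \<subseteq> B \<and> (\<forall>x\<in>B - A. \<theta> `` {x} \<noteq> {x})"
  then have AB: "A \<subseteq> B" and BU: "B \<subseteq> U" and clA: "\<theta> `` A \<subseteq> A" and clB: "\<theta> `` B \<subseteq> B"
    and nontriv: "\<And>x. x \<in> B \<Longrightarrow> x \<notin> A \<Longrightarrow> \<theta> `` {x} \<noteq> {x}"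
    by simp_all
  have cl: "\<theta> `` {x} = \<theta> `` {y} \<and> x \<in> U \<and> y \<in> U" if "(x, y) \<in> \<theta>" for x y
    using that eq by (auto simp: equiv_class_eq_iff)
  have self: "(x, x) \<in> \<theta>" if "x \<in> U" for x
    using that equiv_class_self[OF eq] by auto
  define r where "r C = (SOME x. x \<in> C)" for C :: "'a set"
  have r: "(x, r (\<theta> `` {x})) \<in> \<theta>" if "x \<in> U" for x
    using someI[of "\<lambda>y. y \<in> \<theta> `` {x}" x] self[OF that] by (auto simp: r_def)
  define X where "X = A \<union> {r (\<theta> `` {x}) | x. x \<in> B - A}"
  have rB: "r (\<theta> `` {x}) \<in> B - A" if "x \<in> B - A" for x
  proof -
    have "(x, r (\<theta> `` {x})) \<in> \<theta>" using r that BU by auto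
    moreover from this have "(r (\<theta> `` {x}), x) \<in> \<theta>"
      using eq by (meson equivE symD)
    ultimately show ?thesis using that clA clB by blast
  qed
  have XB: "X \<subseteq> B" using rB AB by (auto simp: X_def)
  have low: "A = {x \<in> U. \<theta> `` {x} \<subseteq> X}"
  proof (intro set_eqI iffI)
    fix x assume "x \<in> A"
    then show "x \<in> {x \<in> U. \<theta> `` {x} \<subseteq> X}" using AB BU clA by (auto simp: X_def)
  next
    fix x assume "x \<in> {x \<in> U. \<theta> `` {x} \<subseteq> X}"
    then have xU: "x \<in> U" and sub: "\<theta> `` {x} \<subseteq> X" by auto
    show "x \<in> A"
    proof (rule ccontr)
      assume "x \<notin> A"
      then have xBA: "x \<in> B - A" using sub self[OF xU] XB by auto
      have const: "y = r (\<theta> `` {x})" if y: "y \<in> \<theta> `` {x}" for y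
      proof -
        have "(x, y) \<in> \<theta>" using y by simp
        then have "(y, x) \<in> \<theta>" using eq by (meson equivE symD)
        then have "y \<notin> A" using \<open>x \<notin> A\<close> clA by blast
        then obtain z where z: "z \<in> B - A" "y = r (\<theta> `` {z})"
          using sub y by (auto simp: X_def)
        then have "(z, y) \<in> \<theta>" using r BU by auto
        then have "\<theta> `` {z} = \<theta> `` {x}" using cl \<open>(y, x) \<in> \<theta>\<close> by metis
        then show ?thesis using z by simp
      qed
      have xin: "x \<in> \<theta> `` {x}" using self[OF xU] by simp
      have "y = x" if "y \<in> \<theta> `` {x}" for y
        by (rule trans[OF const[OF that] const[OF xin, symmetric]])
      then have "\<theta> `` {x} = {x}" using xin by blast
      moreover have "\<theta> `` {x} \<noteq> {x}" using xBA nontriv by simp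
      ultimately show False by contradiction
    qed
  qed
  have up: "B = {x \<in> U. \<theta> `` {x} \<inter> X \<noteq> {}}"
  proof (intro set_eqI iffI)
    fix x assume x: "x \<in> B"
    then have xU: "x \<in> U" using BU by auto
    show "x \<in> {x \<in> U. \<theta> `` {x} \<inter> X \<noteq> {}}"
    proof (cases "x \<in> A")
      case True then show ?thesis using xU self by (auto simp: X_def)
    next
      case False
      then have "r (\<theta> `` {x}) \<in> \<theta> `` {x} \<inter> X" using r[OF xU] x by (auto simp: X_def)
      then show ?thesis using xU by blast
    qed
  next
    fix x assume "x \<in> {x \<in> U. \<theta> `` {x} \<inter> X \<noteq> {}}"
    then obtain y where "(x, y) \<in> \<theta>" "y \<in> B" using XB by auto
    moreover then have "(y, x) \<in> \<theta>" using eq by (meson equivE symD)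
    ultimately show "x \<in> B" using clB by blast
  qed
  have "X \<subseteq> U" using XB BU by auto
  then show "\<exists>X\<subseteq>U. (A, B) = rough_set U \<theta> X"
    using low up lower_approx_eq[OF eq \<open>X \<subseteq> U\<close>] upper_approx_eq[OF eq \<open>X \<subseteq> U\<close>]
    unfolding rough_set_def by (intro exI[of _ X]) simp
qed

lemma carr_rough_set_algebra:
  assumes "equiv U \<theta>"
  shows "p \<in> dsa_carr (rough_set_algebra U \<theta>) \<longleftrightarrow>
    fst p \<subseteq> snd p \<and> snd p \<subseteq> U \<and> \<theta> `` fst p \<subseteq> fst p \<and> \<theta> `` snd p \<subseteq> snd p \<and>
    (\<forall>x\<in>snd p - fst p. \<theta> `` {x} \<noteq> {x})"
proof -
  have "p \<in> dsa_carr (rough_set_algebra U \<theta>) \<longleftrightarrow> (\<exists>X\<subseteq>U. p = rough_set U \<theta> X)"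
    unfolding rough_set_algebra_def by (simp, blast)
  then show ?thesis
    using rough_set_iff[OF assms, of "fst p" "snd p"] by (simp only: prod.collapse)
qed

theorem rough_set_algebra_regular_double_stone:
  assumes "approximation_space U \<theta>"
  shows "regular_double_stone_algebra (rough_set_algebra U \<theta>)"
proof -
  have eq: "equiv U \<theta>" using assms by (simp add: approximation_space_def)
  have compl: "\<theta> `` (U - A) \<subseteq> U - A" if "\<theta> `` A \<subseteq> A" for A
  proof
    fix y assume "y \<in> \<theta> `` (U - A)"
    then obtain x where "(x, y) \<in> \<theta>" "x \<in> U - A" by auto
    moreover then have "(y, x) \<in> \<theta>" "y \<in> U"
      using eq by (meson equivE symD, simp add: equiv_class_eq_iff)
    ultimately show "y \<in> U - A" using that by blast
  qed
  have imU: "\<theta> `` U \<subseteq> U" using eq by (auto simp: equiv_class_eq_iff)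
  note carr = carr_rough_set_algebra[OF eq]
  let ?R = "rough_set_algebra U \<theta>"
  have ops: "dsa_zero ?R = ({}, {})" "dsa_one ?R = (U, U)"
    "dsa_join ?R p q = (fst p \<union> fst q, snd p \<union> snd q)"
    "dsa_meet ?R p q = (fst p \<inter> fst q, snd p \<inter> snd q)"
    "dsa_star ?R p = (U - snd p, U - snd p)"
    "dsa_plus ?R p = (U - fst p, U - fst p)" for p q
    by (simp_all add: rough_set_algebra_def)
  show ?thesis
  proof
    show "dsa_zero ?R \<in> dsa_carr ?R"
      "dsa_one ?R \<in> dsa_carr ?R"
      unfolding carr using imU by (auto simp: ops)
  next
    fix x y assume x: "x \<in> dsa_carr ?R" and y: "y \<in> dsa_carr ?R"
    note xy = x[unfolded carr] y[unfolded carr]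
    have sub: "fst x \<subseteq> snd x" "snd x \<subseteq> U" "fst y \<subseteq> snd y" "snd y \<subseteq> U"
      using xy by auto
    show "dsa_join ?R x y \<in> dsa_carr ?R"
      "dsa_meet ?R x y \<in> dsa_carr ?R"
      unfolding carr using xy by (simp_all add: ops) blast+
    show "(dsa_meet ?R x y = dsa_zero ?R) =
      (dsa_meet ?R y (dsa_star ?R x) = y)"
      using sub by (simp add: ops prod_eq_iff) blast
    show "(dsa_join ?R x y = dsa_one ?R) =
      (dsa_meet ?R (dsa_plus ?R x) y = dsa_plus ?R x)"
      using sub by (simp add: ops prod_eq_iff) blast
    show "dsa_meet ?R (dsa_meet ?R x (dsa_plus ?R x))
        (dsa_join ?R y (dsa_star ?R y)) =
      dsa_meet ?R x (dsa_plus ?R x)"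
      using sub by (simp add: ops prod_eq_iff) blast
  next
    fix x assume x: "x \<in> dsa_carr ?R"
    show "dsa_star ?R x \<in> dsa_carr ?R"
      "dsa_plus ?R x \<in> dsa_carr ?R"
      using x compl unfolding carr by (simp_all add: ops)
    show "dsa_meet ?R x (dsa_one ?R) = x"
      using x unfolding carr by (simp add: ops prod_eq_iff) blast
    show "dsa_join ?R (dsa_star ?R x)
        (dsa_star ?R (dsa_star ?R x)) = dsa_one ?R"
      by (simp add: ops) blast
  qed (simp_all add: ops prod_eq_iff Un_ac Int_ac Int_Un_distrib)
qed

end

theory Submission
  imports Defs
begin

text \<open>On a rough set, \<open>dsa_star\<close> complements the upper approximation and
  \<open>dsa_plus\<close> the lower one. Both lie in \<open>U\<close>, so the two operations agree
  exactly when the approximations coincide. Hence the center consists of the pairs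
  \<open>(A, A)\<close> with \<open>A\<close> saturated under \<theta>
  (\<open>center_rough_set_algebra\<close>). Saturated subsets of \<open>U\<close> are exactly the
  unions of \<theta>-classes, hence are given by sets of indices
  (\<open>saturated_iff_Union_classes\<close>), and a representative generates its class.\<close>

lemma center_rough_set_algebra:
  assumes "equiv U \<theta>"
  shows "center (rough_set_algebra U \<theta>) = {(A, A) | A. A \<subseteq> U \<and> \<theta> `` A \<subseteq> A}"
proof (intro set_eqI iffI)
  fix p assume "p \<in> center (rough_set_algebra U \<theta>)"
  then have p: "p \<in> dsa_carr (rough_set_algebra U \<theta>)" and "U - snd p = U - fst p"
    by (auto simp: center_def rough_set_algebra_def)
  moreover have "fst p \<subseteq> snd p" "snd p \<subseteq> U" "\<theta> `` snd p \<subseteq> snd p"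
    using p unfolding carr_rough_set_algebra[OF assms] by auto
  \<comment> \<open>Complementation in \<open>U\<close> is injective on subsets of
    \<open>U\<close>.\<close>
  ultimately have "fst p = snd p" by blast
  then show "p \<in> {(A, A) | A. A \<subseteq> U \<and> \<theta> `` A \<subseteq> A}"
    using \<open>snd p \<subseteq> U\<close> \<open>\<theta> `` snd p \<subseteq> snd p\<close> by (cases p) auto
next
  fix p assume "p \<in> {(A, A) | A. A \<subseteq> U \<and> \<theta> `` A \<subseteq> A}"
  then obtain A where "p = (A, A)" "A \<subseteq> U" "\<theta> `` A \<subseteq> A" by blast
  \<comment> \<open>The boundary \<open>A - A\<close> is empty, so the condition on singleton
    classes holds vacuously.\<close>
  then have "p \<in> dsa_carr (rough_set_algebra U \<theta>)"
    by (simp add: carr_rough_set_algebra[OF assms])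
  then show "p \<in> center (rough_set_algebra U \<theta>)"
    using \<open>p = (A, A)\<close> by (simp add: center_def rough_set_algebra_def)
qed

text \<open>A saturated set contains the whole class of each of its points, so it is the union of
  the classes inside it; conversely, each class is closed under \<theta>, and so is any union of
  classes.\<close>

lemma saturated_iff_Union_classes:
  assumes eq: "equiv U \<theta>" and bij: "bij_betw cls E (U // \<theta>)"
  shows "A \<subseteq> U \<and> \<theta> `` A \<subseteq> A \<longleftrightarrow> (\<exists>B\<subseteq>E. A = \<Union> (cls ` B))"
proof
  assume A: "A \<subseteq> U \<and> \<theta> `` A \<subseteq> A"
  have "A = \<Union> (cls ` {e \<in> E. cls e \<subseteq> A})"
  proof (rule subset_antisym)
    show "A \<subseteq> \<Union> (cls ` {e \<in> E. cls e \<subseteq> A})"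
    proof
      fix x assume "x \<in> A"
      then have x: "x \<in> \<theta> `` {x}" "\<theta> `` {x} \<subseteq> A"
        using A equiv_class_self[OF eq] by auto
      \<comment> \<open>Surjectivity of \<open>cls\<close> onto the quotient supplies an index for
        the class of \<open>x\<close>.\<close>
      have "\<theta> `` {x} \<in> cls ` E"
        using \<open>x \<in> A\<close> A unfolding bij_betw_imp_surj_on[OF bij] by (intro quotientI) auto
      then obtain e where "e \<in> E" "\<theta> `` {x} = cls e" by (rule imageE)
      then show "x \<in> \<Union> (cls ` {e \<in> E. cls e \<subseteq> A})" using x by (intro UN_I[of e]) auto
    qed
    show "\<Union> (cls ` {e \<in> E. cls e \<subseteq> A}) \<subseteq> A" by (rule UN_least) simp
  qed
  then show "\<exists>B\<subseteq>E. A = \<Union> (cls ` B)" by (intro exI[of _ "{e \<in> E. cls e \<subseteq> A}"]) simp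
next
  assume "\<exists>B\<subseteq>E. A = \<Union> (cls ` B)"
  then obtain B where B: "B \<subseteq> E" "A = \<Union> (cls ` B)" by blast
  have cls: "cls e \<in> U // \<theta>" if "e \<in> B" for e
    using that B(1) bij_betwE[OF bij] by blast
  have "cls ` B \<subseteq> U // \<theta>" by (intro image_subsetI cls)
  then have "A \<subseteq> U" using Union_mono[of "cls ` B" "U // \<theta>"] by (simp add: B(2) Union_quotient[OF eq])
  moreover have "\<theta> `` A \<subseteq> A"
  proof
    fix z assume "z \<in> \<theta> `` A"
    then obtain e x where e: "e \<in> B" "x \<in> cls e" "(x, z) \<in> \<theta>" using B(2) by auto
    have "z \<in> cls e" by (rule in_quotient_imp_closed[OF eq cls[OF e(1)] e(2,3)])
    then show "z \<in> A" using e(1) B(2) by auto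
  qed
  ultimately show "A \<subseteq> U \<and> \<theta> `` A \<subseteq> A" by simp
qed

theorem proposition1:
  fixes U :: "'a set" and \<theta> :: "'a rel"
    and E :: "'e set" and cls :: "'e \<Rightarrow> 'a set" and y :: "'e \<Rightarrow> 'a"
  assumes "approximation_space U \<theta>"
    and "bij_betw cls E (U // \<theta>)"
    and "\<And>e. e \<in> E \<Longrightarrow> y e \<in> cls e"
  shows "center (rough_set_algebra U \<theta>) =
    {(\<Union>e\<in>B. \<theta> `` {y e}, \<Union>e\<in>B. \<theta> `` {y e}) | B. B \<in> Pow E}"
proof -
  have eq: "equiv U \<theta>" using assms(1) by (simp add: approximation_space_def)
  \<comment> \<open>Any member of a class generates it, so the choice of \<open>y e\<close> does not
    matter.\<close>
  have cls: "\<theta> `` {y e} = cls e" if "e \<in> E" for e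
  proof -
    have "cls e \<in> U // \<theta>" using that bij_betwE[OF assms(2)] by blast
    then obtain x where "cls e = \<theta> `` {x}" by (rule quotientE)
    then show ?thesis using assms(3)[OF that] equiv_class_eq[OF eq, of x "y e"] by simp
  qed
  have union: "(\<Union>e\<in>B. \<theta> `` {y e}) = \<Union> (cls ` B)" if "B \<subseteq> E" for B
    using that by (intro SUP_cong refl cls) auto
  have "center (rough_set_algebra U \<theta>) = {(\<Union> (cls ` B), \<Union> (cls ` B)) | B. B \<in> Pow E}"
    unfolding center_rough_set_algebra[OF eq] saturated_iff_Union_classes[OF eq assms(2)] Pow_iff
    by (rule Collect_cong) auto
  \<comment> \<open>As an image over \<open>Pow E\<close>, the set can be rewritten by
    \<open>image_cong\<close>, which provides the assumption \<open>B \<in> Pow E\<close> that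
    \<open>union\<close> requires.\<close>
  also have "\<dots> = (\<lambda>B. (\<Union> (cls ` B), \<Union> (cls ` B))) ` Pow E" by (rule Setcompr_eq_image)
  also have "\<dots> = (\<lambda>B. (\<Union>e\<in>B. \<theta> `` {y e}, \<Union>e\<in>B. \<theta> `` {y e})) ` Pow E"
    by (rule image_cong) (simp_all only: union Pow_iff)
  also have "\<dots> = {(\<Union>e\<in>B. \<theta> `` {y e}, \<Union>e\<in>B. \<theta> `` {y e}) | B. B \<in> Pow E}"
    by (rule Setcompr_eq_image[symmetric])
  finally show ?thesis .
qed

end
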